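(* Let $\mathcal M$ be a (standard) unital $C^*$-algebra. (i) Let $\{a_n\}_{n\in\mathbb N}\subset\mathcal M$ be an almost projection sequence. Then for every real $\epsilon>0$ there is $n\in\mathbb N$ such that for all $m\in\mathbb N$ with $m>n$ there is a projection $p\in\mathcal M$ with $\|a_m-p\|<\epsilon$. (ii) Let $\{u_n\}_{n\in\mathbb N}\subset\mathcal M$ be an almost partial isometry sequence. Then for every real $\epsilon>0$ there is $n\in\mathbb N$ such that for all $m\in\mathbb N$ with $m>n$ there is a partial isometry $u\in\mathcal M$ with $\|u_m-u\|<\epsilon$. (iii) Let $\{a_n\}_{n\in\mathbb N},\{b_n\}_{n\in\mathbb N}\subset\mathcal M$ be almost projection sequences with $\{a_n\}\sim_{\mathrm A}\{b_n\}$. Then for every real $\epsilon>0$ there is $n\in\mathbb N$ such that for all $m\in\mathbb N$ with $m>n$ there are projections $p,q\in\mathcal M$ with $p\sim q$ and $\|a_m-p\|+\|b_m-q\|<\epsilon$.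
   Context: A sequence $\{a_n\}_{n\in\mathbb N}\subset\mathcal M$ (not necessarily convergent) is an almost projection sequence (a.p.s.) if $\|a_n-a_n^*\|+\|a_n^2-a_n\|\to0$. A sequence $\{u_n\}_{n\in\mathbb N}\subset\mathcal M$ is an almost partial isometry sequence (a.p.i.s.) if both $\{u_nu_n^*\}$ and $\{u_n^*u_n\}$ are a.p.s. For a.p.s. $\{a_n\},\{b_n\}$, write $\{a_n\}\sim_{\mathrm A}\{b_n\}$ if there is an a.p.i.s. $\{u_n\}\subset\mathcal M$ with $\|u_nu_n^*-a_n\|+\|u_n^*u_n-b_n\|\to0$. For projections $p,q\in\mathcal M$, $p\sim q$ denotes Murray–von Neumann equivalence: $u^*u=p$, $uu^*=q$ for some partial isometry $u\in\mathcal M$. *)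

theory Defs
  imports Complex_Main
begin

(* Unital C*-algebras. Using monoid_mult instead of real_normed_algebra_1 keeps the zero
   algebra as an instance; norm 1 = 1 in all other cases follows from the C*-identity. *)
class unital_cstar_algebra = real_normed_algebra + banach + monoid_mult +
  fixes scaleC :: "complex \<Rightarrow> 'a \<Rightarrow> 'a"
    and adj :: "'a \<Rightarrow> 'a"
  assumes scaleC_add_right: "scaleC c (x + y) = scaleC c x + scaleC c y"
    and scaleC_add_left: "scaleC (c + d) x = scaleC c x + scaleC d x"
    and scaleC_scaleC: "scaleC c (scaleC d x) = scaleC (c * d) x"
    and scaleC_of_real: "scaleC (complex_of_real r) x = scaleR r x"
    and mult_scaleC_left: "scaleC c x * y = scaleC c (x * y)"
    and mult_scaleC_right: "x * scaleC c y = scaleC c (x * y)"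
    and norm_scaleC: "norm (scaleC c x) = cmod c * norm x"
    and adj_adj: "adj (adj x) = x"
    and adj_add: "adj (x + y) = adj x + adj y"
    and adj_mult: "adj (x * y) = adj y * adj x"
    and adj_scaleC: "adj (scaleC c x) = scaleC (cnj c) (adj x)"
    and cstar_identity: "norm (adj x * x) = (norm x)\<^sup>2"

instantiation complex :: unital_cstar_algebra
begin

definition scaleC_complex :: "complex \<Rightarrow> complex \<Rightarrow> complex"
  where "scaleC_complex c x = c * x"

definition adj_complex :: "complex \<Rightarrow> complex"
  where "adj_complex = cnj"

instance
  by standard (auto simp: scaleC_complex_def adj_complex_def algebra_simps norm_mult
    power2_eq_square scaleR_conv_of_real)

end

definition is_projection :: "'a::unital_cstar_algebra \<Rightarrow> bool"
  where "is_projection p \<longleftrightarrow> adj p = p \<and> p\<^sup>2 = p"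

definition is_partial_isometry :: "'a::unital_cstar_algebra \<Rightarrow> bool"
  where "is_partial_isometry u \<longleftrightarrow> is_projection (u * adj u) \<and> is_projection (adj u * u)"

(* Murray--von Neumann equivalence; only meant to be used for projections p, q. *)
definition mvn_equiv :: "'a::unital_cstar_algebra \<Rightarrow> 'a \<Rightarrow> bool"
  where "mvn_equiv p q \<longleftrightarrow> (\<exists>u. is_partial_isometry u \<and> adj u * u = p \<and> u * adj u = q)"

definition almost_projection_seq :: "(nat \<Rightarrow> 'a::unital_cstar_algebra) \<Rightarrow> bool"
  where "almost_projection_seq a \<longleftrightarrow>
    (\<lambda>n. norm (a n - adj (a n)) + norm ((a n)\<^sup>2 - a n)) \<longlonglongrightarrow> 0"

definition almost_partial_isometry_seq :: "(nat \<Rightarrow> 'a::unital_cstar_algebra) \<Rightarrow> bool"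
  where "almost_partial_isometry_seq u \<longleftrightarrow>
    almost_projection_seq (\<lambda>n. u n * adj (u n)) \<and>
    almost_projection_seq (\<lambda>n. adj (u n) * u n)"

(* Only meant to be used for almost projection sequences a, b. *)
definition almost_equiv ::
    "(nat \<Rightarrow> 'a::unital_cstar_algebra) \<Rightarrow> (nat \<Rightarrow> 'a) \<Rightarrow> bool"
  where "almost_equiv a b \<longleftrightarrow>
    (\<exists>u. almost_partial_isometry_seq u \<and>
      (\<lambda>n. norm (u n * adj (u n) - a n) + norm (adj (u n) * u n - b n)) \<longlonglongrightarrow> 0)"

end

theory Submission
  imports Defs "HOL-Analysis.Elementary_Normed_Spaces" "HOL-Analysis.Norm_Arith"
begin

text \<open>
  Everything follows from rounding an element \<open>u\<close> for which \<open>t = u\<^sup>* u\<close> is almost idempotent to a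
  partial isometry. Functional calculus is avoided by a Newton-type iteration: the real map
  \<open>g(s) = (5 s\<^sup>3 - 3 s\<^sup>5) / 2\<close> has the superattracting fixed points 0 and 1, so
  \<open>u \<mapsto> (5 u t - 3 u t\<^sup>2) / 2\<close> squares the error \<open>\<parallel>t\<^sup>2 - t\<parallel>\<close> up to a constant while moving \<open>u\<close> by
  only \<open>O(\<parallel>t\<^sup>2 - t\<parallel>\<^bsup>1/2\<^esup>)\<close>. The iterates converge to a partial isometry \<open>v\<close>. An almost projection
  \<open>a\<close> satisfies the same hypothesis, and its projection is then \<open>v\<^sup>* v\<close>.
\<close>

section \<open>The adjoint as a bounded real-linear isometry\<close>

lemma adj_scaleR: "adj (r *\<^sub>R x) = r *\<^sub>R adj (x :: 'a::unital_cstar_algebra)"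
  by (metis adj_scaleC complex_cnj_complex_of_real scaleC_of_real)

lemma adj_0 [simp]: "adj (0 :: 'a::unital_cstar_algebra) = 0"
  using adj_scaleR[of 0 "0::'a"] by simp

lemma adj_diff: "adj (x - y) = adj x - adj (y :: 'a::unital_cstar_algebra)"
  using adj_add[of "x - y" y] by (simp add: algebra_simps)

lemma norm_adj [simp]: "norm (adj x) = norm (x :: 'a::unital_cstar_algebra)"
proof (rule antisym)
  have le: "norm y \<le> norm (adj y)" for y :: 'a
  proof (cases "norm y = 0")
    case False
    have "norm y * norm y \<le> norm (adj y) * norm y"
      using norm_mult_ineq[of "adj y" y] by (simp add: cstar_identity power2_eq_square)
    then show ?thesis
      using False by (simp add: mult_le_cancel_right)
  qed simp
  show "norm (adj x) \<le> norm x" "norm x \<le> norm (adj x)"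
    using le[of "adj x"] le[of x] by (simp_all add: adj_adj)
qed

lemma bounded_linear_adj: "bounded_linear (adj :: 'a::unital_cstar_algebra \<Rightarrow> 'a)"
  by (rule bounded_linear_intro[where K = 1]) (simp_all add: adj_add adj_scaleR)

lemmas tendsto_adj = bounded_linear.tendsto[OF bounded_linear_adj]

lemma adj_adj_mult [simp]: "adj (adj x * x) = adj x * (x :: 'a::unital_cstar_algebra)"
  by (simp add: adj_mult adj_adj)

section \<open>Partial isometries\<close>

text \<open>With \<open>t = adj v * v\<close> idempotent, \<open>x = v * t - v\<close> satisfies
  \<open>adj x * x = t^3 - 2 t^2 + t = 0\<close>, so the C*-identity forces
  \<open>v * adj v * v = v\<close>. Idempotence of \<open>v * adj v\<close> follows.\<close>

lemma is_partial_isometryI: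
  fixes v :: "'a::unital_cstar_algebra"
  assumes "(adj v * v)\<^sup>2 = adj v * v"
  shows "is_partial_isometry v"
proof -
  have idem: "adj v * v * (adj v * v) = adj v * v"
    using assms by (simp add: power2_eq_square)
  define x where "x = v * adj v * v - v"
  have "adj x * x = adj v * v * (adj v * v) * (adj v * v) - adj v * v * (adj v * v)
      - (adj v * v * (adj v * v) - adj v * v)"
    by (simp add: x_def adj_diff adj_mult adj_adj algebra_simps)
  also have "\<dots> = 0"
    by (simp add: idem)
  finally have "norm x = 0"
    using cstar_identity[of x] by simp
  then have "v * adj v * v = v"
    by (simp add: x_def)
  then have "v * adj v * (v * adj v) = v * adj v"
    by (metis mult.assoc)
  then show ?thesis
    using assms
    by (simp add: is_partial_isometry_def is_projection_def power2_eq_square adj_mult adj_adj)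
qed

lemma norm_partial_isometry_le_1:
  fixes v :: "'a::unital_cstar_algebra"
  assumes "is_partial_isometry v"
  shows "norm v \<le> 1"
proof -
  define p where "p = adj v * v"
  have p: "adj p = p" "p * p = p"
    using assms by (auto simp: is_partial_isometry_def is_projection_def p_def power2_eq_square)
  then have "norm p = (norm p)\<^sup>2"
    using cstar_identity[of p] by simp
  then have "norm p \<le> 1"
    by (auto simp: power2_eq_square)
  then show ?thesis
    using cstar_identity[of v] by (simp add: p_def power_le_one_iff abs_square_le_1)
qed

section \<open>The Newton step and its quadratic convergence\<close>

text \<open>Since \<open>adj u * u\<close> is self-adjoint, this vanishes exactly when
  \<open>u\<close> is a partial isometry; its norm is the error that the iteration controls.\<close>

definition defect :: "'a::unital_cstar_algebra \<Rightarrow> 'a"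
  where "defect u = (adj u * u)\<^sup>2 - adj u * u"

text \<open>The coefficients are forced: \<open>b s^3 + c s^5\<close> fixes 1 with zero derivative
  there iff \<open>b + c = 1\<close> and \<open>3 b + 5 c = 0\<close>. Oddness of the polynomial
  makes the step expressible by \<open>u\<close> and \<open>adj u * u\<close> alone, without square
  roots.\<close>

definition newton_step :: "'a::unital_cstar_algebra \<Rightarrow> 'a"
  where "newton_step u = (5/2) *\<^sub>R (u * (adj u * u)) - (3/2) *\<^sub>R (u * (adj u * u) * (adj u * u))"

text \<open>For self-adjoint \<open>t\<close> the C*-identity gives \<open>norm (t^2) = r^2\<close>
  with \<open>r = norm t\<close>. Hence \<open>r^2 \<le> 1 + r\<close>, which is impossible for
  \<open>r > 2\<close>.\<close>

lemma norm_adj_mult_le_2: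
  fixes u :: "'a::unital_cstar_algebra"
  assumes "norm (defect u) \<le> 1"
  shows "norm (adj u * u) \<le> 2"
proof (rule ccontr)
  let ?t = "adj u * u"
  assume "\<not> ?thesis"
  then have gt: "norm ?t > 2" by simp
  have "(norm ?t)\<^sup>2 = norm (?t\<^sup>2)"
    using cstar_identity[of ?t] by (simp add: power2_eq_square)
  also have "\<dots> \<le> norm (defect u) + norm ?t"
    using norm_triangle_ineq[of "defect u" ?t] by (simp add: defect_def)
  finally have "norm ?t * norm ?t \<le> 1 + norm ?t"
    using assms by (simp add: power2_eq_square)
  moreover have "norm ?t * norm ?t \<ge> 2 * norm ?t"
    using gt by (intro mult_right_mono) auto
  ultimately show False
    using gt by linarith
qed

text \<open>Brings equations between real linear combinations within reach of the method \<open>norm\<close>.\<close>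
lemma norm_diff_eqI: "norm (x - y) \<le> 0 \<Longrightarrow> x = y" for x y :: "'a::real_normed_vector"
  by simp

lemma newton_step_dist:
  fixes u :: "'a::unital_cstar_algebra"
  assumes "norm (defect u) \<le> 1"
  shows "norm (newton_step u - u) \<le> 7 * sqrt (norm (defect u))"
proof -
  define t where "t = adj u * u"
  define x where "x = u * t - u"
  have t2: "norm t \<le> 2"
    using norm_adj_mult_le_2[OF assms] by (simp add: t_def)
  \<comment> \<open>This is \<open>(t - 1) t (t - 1)\<close> with the factor \<open>t^2 - t\<close>
    pulled out. The defect bounds the square of \<open>norm x\<close>, which is where the square
    root in the claim comes from.\<close>
  have "adj x * x = defect u * t - defect u"
    by (simp add: x_def t_def defect_def adj_diff adj_mult adj_adj power2_eq_square algebra_simps)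
  then have "(norm x)\<^sup>2 = norm (defect u * t - defect u)"
    using cstar_identity[of x] by simp
  also have "\<dots> \<le> norm (defect u) * norm t + norm (defect u)"
    by (rule order_trans[OF norm_triangle_ineq4]) (simp add: norm_mult_ineq)
  also have "\<dots> \<le> norm (defect u) * 2 + norm (defect u)"
    using t2 by (intro add_mono mult_left_mono) auto
  finally have x: "(norm x)\<^sup>2 \<le> 3 * norm (defect u)"
    by simp
  have "newton_step u - u = x - (3/2) *\<^sub>R (x * t)"
    by (rule norm_diff_eqI, simp only: newton_step_def x_def t_def algebra_simps mult_scaleR_left) norm
  then have "norm (newton_step u - u) \<le> norm x + 3/2 * norm (x * t)"
    using norm_triangle_ineq4[of x "(3/2) *\<^sub>R (x * t)"] by simp
  also have "\<dots> \<le> norm x + 3/2 * (norm x * 2)"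
    using order_trans[OF norm_mult_ineq[of x t] mult_left_mono[OF t2 norm_ge_zero[of x]]] by simp
  also have "\<dots> = 4 * norm x"
    by simp
  also have "\<dots> \<le> 7 * sqrt (norm (defect u))"
  proof (rule power2_le_imp_le)
    \<comment> \<open>The constant 7 works because \<open>16 * 3 = 48 \<le> 49\<close>.\<close>
    show "(4 * norm x)\<^sup>2 \<le> (7 * sqrt (norm (defect u)))\<^sup>2"
      using x by (simp add: power_mult_distrib order_trans[of _ "48 * norm (defect u)"])
  qed simp
  finally show ?thesis .
qed

text \<open>On the level of \<open>t\<close> the step is \<open>s = t^3 (5 - 3 t)^2 / 4\<close>.
  Here \<open>s\<close> vanishes to third order at 0 and \<open>s - 1\<close> to second order at 1,
  so \<open>s^2 - s\<close> is divisible by \<open>(t^2 - t)^2\<close>. The cofactor is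
  \<open>t (3 t - 5)^2 (9 t^3 - 12 t^2 - 8 t - 4) / 16\<close>, expanded.\<close>

lemma defect_newton_step:
  fixes u :: "'a::unital_cstar_algebra"
  defines "t \<equiv> adj u * u"
  shows "defect (newton_step u) = defect u * (defect u *
    ((81/16) *\<^sub>R (t*t*t*t*t*t) - (189/8) *\<^sub>R (t*t*t*t*t) + (513/16) *\<^sub>R (t*t*t*t)
     - 6 *\<^sub>R (t*t*t) - 5 *\<^sub>R (t*t) - (25/4) *\<^sub>R t))"
proof -
  define s where "s = (25/4) *\<^sub>R (t*t*t) - (15/2) *\<^sub>R (t*t*t*t) + (9/4) *\<^sub>R (t*t*t*t*t)"
  have step: "newton_step u = (5/2) *\<^sub>R (u * t) - (3/2) *\<^sub>R (u * t * t)"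
    by (simp add: newton_step_def t_def)
  have adj_t: "adj t = t"
    by (simp add: t_def)
  have ut: "adj u * (u * z) = t * z" for z
    by (simp add: t_def mult.assoc)
  have "adj (newton_step u) * newton_step u = s"
    unfolding step s_def
    by (rule norm_diff_eqI, simp only: adj_diff adj_mult adj_scaleR adj_t algebra_simps ut
        mult_scaleR_left mult_scaleR_right scaleR_scaleR) norm
  then have "defect (newton_step u) = s * s - s"
    by (simp add: defect_def power2_eq_square)
  also have "\<dots> = (t*t - t) * ((t*t - t) *
    ((81/16) *\<^sub>R (t*t*t*t*t*t) - (189/8) *\<^sub>R (t*t*t*t*t) + (513/16) *\<^sub>R (t*t*t*t)
     - 6 *\<^sub>R (t*t*t) - 5 *\<^sub>R (t*t) - (25/4) *\<^sub>R t))"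
    unfolding s_def
    by (rule norm_diff_eqI, simp only: algebra_simps mult_scaleR_left mult_scaleR_right scaleR_scaleR)
      norm
  finally show ?thesis
    by (simp add: defect_def t_def power2_eq_square)
qed

lemma norm_defect_newton_step_le:
  fixes u :: "'a::unital_cstar_algebra"
  assumes "norm (defect u) \<le> 1"
  shows "norm (defect (newton_step u)) \<le> 1674 * (norm (defect u))\<^sup>2"
proof -
  define t where "t = adj u * u"
  have t: "norm t \<le> 2"
    using norm_adj_mult_le_2[OF assms] by (simp add: t_def)
  have le: "norm (x * t) \<le> 2 * c" if "norm x \<le> c" for x and c :: real
  proof -
    have "norm x * norm t \<le> c * 2"
      using that t order_trans[OF norm_ge_zero that] by (intro mult_mono) auto
    then show ?thesis
      using norm_mult_ineq[of x t] by simp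
  qed
  note b1 = t
  note b2 = le[OF b1, simplified]
  note b3 = le[OF b2, simplified]
  note b4 = le[OF b3, simplified]
  note b5 = le[OF b4, simplified]
  note b6 = le[OF b5, simplified]
  define q where "q = (81/16) *\<^sub>R (t*t*t*t*t*t) - (189/8) *\<^sub>R (t*t*t*t*t) + (513/16) *\<^sub>R (t*t*t*t)
     - 6 *\<^sub>R (t*t*t) - 5 *\<^sub>R (t*t) - (25/4) *\<^sub>R t"
  have "norm q \<le> 1674"
  proof -
    have "norm q \<le> 81/16 * norm (t*t*t*t*t*t) + 189/8 * norm (t*t*t*t*t) + 513/16 * norm (t*t*t*t)
        + 6 * norm (t*t*t) + 5 * norm (t*t) + 25/4 * norm t"
      unfolding q_def
      by (intro norm_triangle_mono order_trans[OF norm_triangle_ineq4 add_mono]) simp_all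
    \<comment> \<open>Inserting \<open>norm t \<le> 2\<close> gives
      \<open>324 + 756 + 513 + 48 + 20 + 12.5 = 1673.5\<close>.\<close>
    also have "\<dots> \<le> 1674"
      using b1 b2 b3 b4 b5 b6 by linarith
    finally show ?thesis .
  qed
  have "norm (defect (newton_step u)) = norm (defect u * (defect u * q))"
    using defect_newton_step[of u] by (simp add: q_def t_def)
  also have "\<dots> \<le> norm (defect u) * (norm (defect u) * norm q)"
    by (intro order_trans[OF norm_mult_ineq] mult_left_mono norm_mult_ineq) auto
  also have "\<dots> \<le> norm (defect u) * (norm (defect u) * 1674)"
    using \<open>norm q \<le> 1674\<close> by (intro mult_left_mono) auto
  finally show ?thesis
    by (simp add: power2_eq_square mult_ac)
qed

section \<open>Perturbation and rounding of a single element\<close>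

text \<open>Expanding at \<open>u = v + d\<close> leaves one term quadratic in \<open>d\<close> and
  two cross terms, each at most \<open>norm d\<close> because \<open>norm v \<le> 1\<close>. The
  bound thus depends on the distance alone.\<close>

lemma norm_diff_mult_adj_le:
  fixes u v :: "'a::unital_cstar_algebra"
  assumes "is_partial_isometry v"
  shows "norm (u * adj u - v * adj v) \<le> norm (u - v) * (norm (u - v) + 2)"
    and "norm (adj u * u - adj v * v) \<le> norm (u - v) * (norm (u - v) + 2)"
proof -
  define d where "d = u - v"
  have u: "u = v + d"
    by (simp add: d_def)
  have v: "norm v \<le> 1"
    using assms by (rule norm_partial_isometry_le_1)
  have dd: "norm (adj d * d) \<le> norm d * norm d" "norm (d * adj d) \<le> norm d * norm d"
    by (auto intro: order_trans[OF norm_mult_ineq])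
  have dv: "norm (adj d * v) \<le> norm d" "norm (d * adj v) \<le> norm d"
    "norm (v * adj d) \<le> norm d" "norm (adj v * d) \<le> norm d"
    using v by (auto intro!: order_trans[OF norm_mult_ineq] mult_left_le mult_left_le_one_le)
  have "u * adj u - v * adj v = d * adj d + d * adj v + v * adj d"
    "adj u * u - adj v * v = adj d * d + adj d * v + adj v * d"
    by (simp_all add: u adj_add algebra_simps)
  moreover have "norm (d * adj d + d * adj v + v * adj d) \<le> norm d * norm d + norm d + norm d"
    by (intro norm_triangle_mono dd dv)
  moreover have "norm (adj d * d + adj d * v + adj v * d) \<le> norm d * norm d + norm d + norm d"
    by (intro norm_triangle_mono dd dv)
  ultimately show "norm (u * adj u - v * adj v) \<le> norm (u - v) * (norm (u - v) + 2)"
    "norm (adj u * u - adj v * v) \<le> norm (u - v) * (norm (u - v) + 2)"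
    by (simp_all add: d_def[symmetric] algebra_simps)
qed

text \<open>The threshold \<open>1 / (4 * 1674)\<close> makes each Newton step shrink the defect by a factor of 4.\<close>
lemma partial_isometry_near:
  fixes u :: "'a::unital_cstar_algebra"
  assumes small: "norm (defect u) \<le> 1 / 6696"
  shows "\<exists>v. is_partial_isometry v \<and> norm (u - v) \<le> 14 * sqrt (norm (defect u))"
proof -
  define d where "d = norm (defect u)"
  define w where "w n = (newton_step ^^ n) u" for n
  have d: "0 \<le> d" "d \<le> 1 / 6696"
    using small by (simp_all add: d_def)
  have w_Suc: "w (Suc n) = newton_step (w n)" for n
    by (simp add: w_def)
  have defect_w: "norm (defect (w n)) \<le> d * (1/4)^n" for n
  proof (induction n)
    case 0
    then show ?case by (simp add: w_def d_def)
  next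
    case (Suc n)
    let ?x = "norm (defect (w n))"
    have "d * (1/4)^n \<le> d * 1"
      using d by (intro mult_left_mono power_le_one) auto
    then have x: "?x \<le> 1 / 6696"
      using Suc d by linarith
    have "norm (defect (w (Suc n))) \<le> 1674 * ?x\<^sup>2"
      using norm_defect_newton_step_le[of "w n"] x by (simp add: w_Suc)
    also have "\<dots> \<le> ?x / 4"
      using mult_left_mono[OF x, of ?x] by (simp add: power2_eq_square)
    also have "\<dots> \<le> d * (1/4) ^ Suc n"
      using Suc by simp
    finally show ?case .
  qed
  have pow_le: "d * (1/4)^n \<le> d" for n
    using d by (intro mult_left_le power_le_one) auto
  \<comment> \<open>The square root turns the decay rate 1/4 of the defect into 1/2 for the
    displacements; their geometric sum doubles 7 to 14.\<close>
  have step: "norm (w (Suc n) - w n) \<le> 7 * sqrt d * (1/2)^n" for n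
  proof -
    have "norm (w (Suc n) - w n) \<le> 7 * sqrt (norm (defect (w n)))"
      unfolding w_Suc using defect_w[of n] pow_le[of n] d by (intro newton_step_dist) linarith
    also have "\<dots> \<le> 7 * sqrt (d * (1/4)^n)"
      using defect_w[of n] by simp
    also have "\<dots> = 7 * sqrt d * (1/2)^n"
      by (simp add: real_sqrt_mult real_sqrt_power real_sqrt_divide)
    finally show ?thesis .
  qed
  define S where "S = (\<Sum>n. w (Suc n) - w n)"
  have geo: "(\<lambda>n. 7 * sqrt d * (1/2)^n) sums (14 * sqrt d)"
    using sums_mult[OF geometric_sums[of "1/2::real"], of "7 * sqrt d"] by simp
  have "summable (\<lambda>n. w (Suc n) - w n)"
    by (rule summable_comparison_test'[OF sums_summable[OF geo] step])
  then have "(\<lambda>n. w (Suc n) - w n) sums S"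
    unfolding S_def by (rule summable_sums)
  then have "(\<lambda>n. w n - u) \<longlonglongrightarrow> S"
    by (simp add: sums_def sum_lessThan_telescope) (simp add: w_def)
  then have lim: "w \<longlonglongrightarrow> u + S"
    using tendsto_add[OF tendsto_const[of u]] by fastforce
  have "norm S \<le> (\<Sum>n. 7 * sqrt d * (1/2)^n)"
    unfolding S_def by (rule norm_suminf_le[OF step sums_summable[OF geo]])
  then have S: "norm S \<le> 14 * sqrt d"
    using sums_unique[OF geo] by simp
  \<comment> \<open>The defect is continuous, so the limit of the iterates has defect zero.\<close>
  have "(\<lambda>n. defect (w n)) \<longlonglongrightarrow> defect (u + S)"
    unfolding defect_def power2_eq_square by (intro tendsto_intros tendsto_adj lim)
  moreover have "(\<lambda>n. defect (w n)) \<longlonglongrightarrow> 0"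
  proof (rule Lim_null_comparison)
    show "(\<lambda>n. d * (1/4)^n) \<longlonglongrightarrow> 0"
      by (intro tendsto_mult_right_zero LIMSEQ_realpow_zero) auto
  qed (use defect_w in auto)
  ultimately have "defect (u + S) = 0"
    by (rule LIMSEQ_unique)
  then have "is_partial_isometry (u + S)"
    by (intro is_partial_isometryI) (simp add: defect_def)
  then show ?thesis
    using S by (intro exI[of _ "u + S"]) (simp add: d_def)
qed

section \<open>Rounding of sequences\<close>

lemma partial_isometry_seq_near:
  fixes u :: "nat \<Rightarrow> 'a::unital_cstar_algebra"
  assumes "(\<lambda>n. defect (u n)) \<longlonglongrightarrow> 0"
  obtains v where "\<And>n. is_partial_isometry (v n)" "(\<lambda>n. norm (u n - v n)) \<longlonglongrightarrow> 0"
proof -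
  \<comment> \<open>Default value for the indices at which the defect is still too large for
    rounding.\<close>
  have zero: "is_partial_isometry (0 :: 'a)"
    by (simp add: is_partial_isometry_def is_projection_def power2_eq_square)
  have "\<exists>v. is_partial_isometry v \<and>
      (norm (defect (u n)) \<le> 1 / 6696 \<longrightarrow> norm (u n - v) \<le> 14 * sqrt (norm (defect (u n))))" for n
    using partial_isometry_near[of "u n"] zero by blast
  then obtain v where v: "\<And>n. is_partial_isometry (v n)"
    "\<And>n. norm (defect (u n)) \<le> 1 / 6696 \<Longrightarrow> norm (u n - v n) \<le> 14 * sqrt (norm (defect (u n)))"
    by metis
  have lim: "(\<lambda>n. norm (defect (u n))) \<longlonglongrightarrow> 0"
    using assms by (rule tendsto_norm_zero)
  have "(\<lambda>n. norm (u n - v n)) \<longlonglongrightarrow> 0"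
  proof (rule Lim_null_comparison)
    have "eventually (\<lambda>n. norm (defect (u n)) < 1 / 6696) sequentially"
      by (rule order_tendstoD(2)[OF lim]) simp
    then show "eventually (\<lambda>n. norm (norm (u n - v n)) \<le> 14 * sqrt (norm (defect (u n)))) sequentially"
      by eventually_elim (use v in auto)
    show "(\<lambda>n. 14 * sqrt (norm (defect (u n)))) \<longlonglongrightarrow> 0"
      using tendsto_real_sqrt[OF lim] by (intro tendsto_mult_right_zero) simp
  qed
  with v(1) show thesis by (rule that)
qed

lemma tendsto_mult_adj_diff:
  fixes u v :: "nat \<Rightarrow> 'a::unital_cstar_algebra"
  assumes "\<And>n. is_partial_isometry (v n)" and "(\<lambda>n. norm (u n - v n)) \<longlonglongrightarrow> 0"
  shows "(\<lambda>n. u n * adj (u n) - v n * adj (v n)) \<longlonglongrightarrow> 0"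
    and "(\<lambda>n. adj (u n) * u n - adj (v n) * v n) \<longlonglongrightarrow> 0"
proof -
  have lim: "(\<lambda>n. norm (u n - v n) * (norm (u n - v n) + 2)) \<longlonglongrightarrow> 0"
    using tendsto_mult[OF assms(2) tendsto_add[OF assms(2) tendsto_const[of 2]]] by simp
  show "(\<lambda>n. u n * adj (u n) - v n * adj (v n)) \<longlonglongrightarrow> 0"
    "(\<lambda>n. adj (u n) * u n - adj (v n) * v n) \<longlonglongrightarrow> 0"
    using norm_diff_mult_adj_le[OF assms(1)] by (auto intro!: Lim_null_comparison[OF _ lim])
qed

section \<open>Almost projection sequences\<close>

lemma almost_projection_seq_iff:
  "almost_projection_seq a \<longleftrightarrow>
    (\<lambda>n. a n - adj (a n)) \<longlonglongrightarrow> 0 \<and> (\<lambda>n. (a n)\<^sup>2 - a n) \<longlonglongrightarrow> 0"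
  (is "_ \<longleftrightarrow> ?x \<longlonglongrightarrow> 0 \<and> ?y \<longlonglongrightarrow> 0")
proof
  assume "almost_projection_seq a"
  then have lim: "(\<lambda>n. norm (?x n) + norm (?y n)) \<longlonglongrightarrow> 0"
    by (simp add: almost_projection_seq_def)
  show "?x \<longlonglongrightarrow> 0 \<and> ?y \<longlonglongrightarrow> 0"
    by (auto intro!: Lim_null_comparison[OF _ lim])
next
  assume "?x \<longlonglongrightarrow> 0 \<and> ?y \<longlonglongrightarrow> 0"
  then have "(\<lambda>n. norm (?x n) + norm (?y n)) \<longlonglongrightarrow> 0 + 0"
    by (intro tendsto_add tendsto_norm_zero) auto
  then show "almost_projection_seq a"
    by (simp add: almost_projection_seq_def)
qed

lemma almost_partial_isometry_seq_defect:
  "almost_partial_isometry_seq u \<Longrightarrow> (\<lambda>n. defect (u n)) \<longlonglongrightarrow> 0"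
  by (simp add: almost_partial_isometry_seq_def almost_projection_seq_iff defect_def)

text \<open>Boundedness is not part of the definition of an almost projection sequence and has to be
  extracted. Writing \<open>adj a * a\<close> as \<open>a^2 - (a - adj a) * a\<close>, the
  C*-identity yields \<open>r^2 \<le> 1 + 2 r\<close> for \<open>r = norm a\<close>, which excludes
  \<open>r > 3\<close>.\<close>

lemma almost_projection_norm_le:
  fixes a :: "'a::unital_cstar_algebra"
  assumes "norm (a - adj a) \<le> 1" and "norm (a\<^sup>2 - a) \<le> 1"
  shows "norm a \<le> 3"
proof (rule ccontr)
  assume "\<not> ?thesis"
  then have gt: "norm a > 3" by simp
  have "adj a * a = (a\<^sup>2 - a) + a - (a - adj a) * a"
    by (simp add: algebra_simps power2_eq_square)
  then have "(norm a)\<^sup>2 = norm ((a\<^sup>2 - a) + a - (a - adj a) * a)"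
    using cstar_identity[of a] by simp
  also have "\<dots> \<le> norm (a\<^sup>2 - a) + norm a + norm ((a - adj a) * a)"
    by norm
  also have "\<dots> \<le> 1 + norm a + 1 * norm a"
    using assms by (intro add_mono order_trans[OF norm_mult_ineq] mult_right_mono) auto
  finally have "norm a * norm a \<le> 1 + 2 * norm a"
    by (simp add: power2_eq_square)
  moreover have "norm a * norm a \<ge> 3 * norm a"
    using gt by (intro mult_right_mono) auto
  ultimately show False
    using gt by linarith
qed

text \<open>This makes rounding applicable to \<open>a\<close>: the difference
  \<open>a - adj a * a\<close> equals \<open>(a - adj a) * a - (a^2 - a)\<close>, a null sequence
  because \<open>a\<close> is eventually bounded.\<close>

lemma almost_projection_seq_adj_mult:
  fixes a :: "nat \<Rightarrow> 'a::unital_cstar_algebra"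
  assumes "almost_projection_seq a"
  shows "(\<lambda>n. a n - adj (a n) * a n) \<longlonglongrightarrow> 0" and "(\<lambda>n. defect (a n)) \<longlonglongrightarrow> 0"
proof -
  have sa: "(\<lambda>n. a n - adj (a n)) \<longlonglongrightarrow> 0" and idem: "(\<lambda>n. (a n)\<^sup>2 - a n) \<longlonglongrightarrow> 0"
    using assms by (auto simp: almost_projection_seq_iff)
  have "eventually (\<lambda>n. norm (a n - adj (a n)) < 1) sequentially"
    "eventually (\<lambda>n. norm ((a n)\<^sup>2 - a n) < 1) sequentially"
    using order_tendstoD(2)[OF tendsto_norm_zero[OF sa]]
      order_tendstoD(2)[OF tendsto_norm_zero[OF idem]] by simp_all
  then have "eventually (\<lambda>n. norm (a n) \<le> 3) sequentially"
    by eventually_elim (rule almost_projection_norm_le, auto)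
  then have bdd: "Bfun a sequentially"
    by (rule BfunI)
  have mult_right: "(\<lambda>n. x n * a n) \<longlonglongrightarrow> 0" and mult_left: "(\<lambda>n. a n * x n) \<longlonglongrightarrow> 0"
    if "x \<longlonglongrightarrow> 0" for x
    using bounded_bilinear.Zfun_prod_Bfun[OF bounded_bilinear_mult _ bdd, of x]
      bounded_bilinear.Bfun_prod_Zfun[OF bounded_bilinear_mult bdd, of x] that
    by (simp_all add: tendsto_Zfun_iff)
  have "(\<lambda>n. (a n - adj (a n)) * a n - ((a n)\<^sup>2 - a n)) \<longlonglongrightarrow> 0 - 0"
    by (intro tendsto_diff mult_right sa idem)
  then show x: "(\<lambda>n. a n - adj (a n) * a n) \<longlonglongrightarrow> 0"
    by (simp add: algebra_simps power2_eq_square)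
  let ?x = "\<lambda>n. a n - adj (a n) * a n"
  \<comment> \<open>Expansion of \<open>(a - x)^2 - (a - x)\<close>, where
    \<open>a - x = adj a * a\<close>.\<close>
  have "(\<lambda>n. ((a n)\<^sup>2 - a n) + ?x n - a n * ?x n - ?x n * a n + ?x n * ?x n) \<longlonglongrightarrow> 0 + 0 - 0 - 0 + 0 * 0"
    by (intro tendsto_add tendsto_diff tendsto_mult mult_left mult_right x idem)
  then show "(\<lambda>n. defect (a n)) \<longlonglongrightarrow> 0"
    by (simp add: defect_def algebra_simps power2_eq_square)
qed

lemma tendsto_0_ex_greater:
  fixes f :: "nat \<Rightarrow> real"
  assumes "f \<longlonglongrightarrow> 0" and "\<epsilon> > 0"
  shows "\<exists>n. \<forall>m. m > n \<longrightarrow> f m < \<epsilon>"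
  using order_tendstoD(2)[OF assms] by (auto simp: eventually_sequentially intro: less_imp_le)

theorem corollary37:
  shows "(\<forall>a :: nat \<Rightarrow> 'a::unital_cstar_algebra.
            almost_projection_seq a \<longrightarrow>
            (\<forall>\<epsilon>::real. \<epsilon> > 0 \<longrightarrow>
              (\<exists>n. \<forall>m. m > n \<longrightarrow> (\<exists>p. is_projection p \<and> norm (a m - p) < \<epsilon>)))) \<and>
         (\<forall>u :: nat \<Rightarrow> 'a.
            almost_partial_isometry_seq u \<longrightarrow>
            (\<forall>\<epsilon>::real. \<epsilon> > 0 \<longrightarrow>
              (\<exists>n. \<forall>m. m > n \<longrightarrow> (\<exists>v. is_partial_isometry v \<and> norm (u m - v) < \<epsilon>)))) \<and>
         (\<forall>(a :: nat \<Rightarrow> 'a) (b :: nat \<Rightarrow> 'a).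
            almost_projection_seq a \<longrightarrow> almost_projection_seq b \<longrightarrow> almost_equiv a b \<longrightarrow>
            (\<forall>\<epsilon>::real. \<epsilon> > 0 \<longrightarrow>
              (\<exists>n. \<forall>m. m > n \<longrightarrow>
                (\<exists>p q. is_projection p \<and> is_projection q \<and> mvn_equiv p q \<and>
                       norm (a m - p) + norm (b m - q) < \<epsilon>))))"
proof (intro conjI allI impI)
  fix a :: "nat \<Rightarrow> 'a" and \<epsilon> :: real
  assume a: "almost_projection_seq a" and \<epsilon>: "\<epsilon> > 0"
  obtain v where v: "\<And>n. is_partial_isometry (v n)" "(\<lambda>n. norm (a n - v n)) \<longlonglongrightarrow> 0"
    using almost_projection_seq_adj_mult(2)[OF a] by (rule partial_isometry_seq_near) blast
  \<comment> \<open>The rounded \<open>v\<close> need not be a projection, so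
    \<open>adj v * v\<close> is taken instead; it is compared with \<open>a\<close> through
    \<open>adj a * a\<close>.\<close>
  have "(\<lambda>n. (a n - adj (a n) * a n) + (adj (a n) * a n - adj (v n) * v n)) \<longlonglongrightarrow> 0 + 0"
    by (intro tendsto_add almost_projection_seq_adj_mult(1) a tendsto_mult_adj_diff(2) v)
  then have "(\<lambda>n. norm (a n - adj (v n) * v n)) \<longlonglongrightarrow> 0"
    by (simp add: tendsto_norm_zero)
  then show "\<exists>n. \<forall>m. m > n \<longrightarrow> (\<exists>p. is_projection p \<and> norm (a m - p) < \<epsilon>)"
    using tendsto_0_ex_greater[OF _ \<epsilon>] v(1) unfolding is_partial_isometry_def by meson
next
  fix u :: "nat \<Rightarrow> 'a" and \<epsilon> :: real
  assume u: "almost_partial_isometry_seq u" and \<epsilon>: "\<epsilon> > 0"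
  obtain v where "\<And>n. is_partial_isometry (v n)" "(\<lambda>n. norm (u n - v n)) \<longlonglongrightarrow> 0"
    using almost_partial_isometry_seq_defect[OF u] by (rule partial_isometry_seq_near) blast
  then show "\<exists>n. \<forall>m. m > n \<longrightarrow> (\<exists>v. is_partial_isometry v \<and> norm (u m - v) < \<epsilon>)"
    using tendsto_0_ex_greater[OF _ \<epsilon>] by meson
next
  fix a b :: "nat \<Rightarrow> 'a" and \<epsilon> :: real
  assume "almost_equiv a b" and \<epsilon>: "\<epsilon> > 0"
  then obtain u where u: "almost_partial_isometry_seq u"
    and near: "(\<lambda>n. norm (u n * adj (u n) - a n) + norm (adj (u n) * u n - b n)) \<longlonglongrightarrow> 0"
    by (auto simp: almost_equiv_def)
  obtain v where v: "\<And>n. is_partial_isometry (v n)" "(\<lambda>n. norm (u n - v n)) \<longlonglongrightarrow> 0"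
    using almost_partial_isometry_seq_defect[OF u] by (rule partial_isometry_seq_near) blast
  define f where "f n = norm (a n - v n * adj (v n)) + norm (b n - adj (v n) * v n)" for n
  have lim: "(\<lambda>n. norm (u n * adj (u n) - a n) + norm (adj (u n) * u n - b n)
      + norm (u n * adj (u n) - v n * adj (v n)) + norm (adj (u n) * u n - adj (v n) * v n))
      \<longlonglongrightarrow> 0"
    using tendsto_add[OF tendsto_add[OF near tendsto_norm_zero[OF tendsto_mult_adj_diff(1)[OF v]]]
        tendsto_norm_zero[OF tendsto_mult_adj_diff(2)[OF v]]] by simp
  have tri: "norm (x - z) \<le> norm (y - x) + norm (y - z)" for x y z :: 'a
    by norm
  have "f \<longlonglongrightarrow> 0"
  proof (rule Lim_null_comparison[OF always_eventually lim], rule allI)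
    fix n
    show "norm (f n) \<le> norm (u n * adj (u n) - a n) + norm (adj (u n) * u n - b n)
      + norm (u n * adj (u n) - v n * adj (v n)) + norm (adj (u n) * u n - adj (v n) * v n)"
      using tri[of "a n" "v n * adj (v n)" "u n * adj (u n)"]
        tri[of "b n" "adj (v n) * v n" "adj (u n) * u n"] by (simp add: f_def)
  qed
  then have "\<exists>n. \<forall>m. m > n \<longrightarrow> f m < \<epsilon>"
    using \<epsilon> by (intro tendsto_0_ex_greater) simp_all
  \<comment> \<open>In \<open>almost_equiv\<close> the first sequence is near
    \<open>u * adj u\<close>, whereas \<open>mvn_equiv\<close> starts from \<open>adj u * u\<close>.
    The witness is therefore \<open>adj (v m)\<close>.\<close>
  moreover have "is_projection (v m * adj (v m)) \<and> is_projection (adj (v m) * v m) \<and>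
      mvn_equiv (v m * adj (v m)) (adj (v m) * v m)" for m
    using v(1)[of m] unfolding mvn_equiv_def is_partial_isometry_def
    by (auto intro!: exI[of _ "adj (v m)"] simp: adj_adj)
  ultimately show "\<exists>n. \<forall>m. m > n \<longrightarrow>
      (\<exists>p q. is_projection p \<and> is_projection q \<and> mvn_equiv p q \<and>
        norm (a m - p) + norm (b m - q) < \<epsilon>)"
    unfolding f_def by meson
qed

end
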